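(* Let $K$ be a compact semitopological semihypergroup and $I$ be a minimal left ideal in $K$. Then $$\bigcup_{M\in\mathcal{L}(K)} M\ \subset\ \mathrm{Ker}(K)\ \subset\ \bigcup_{x\in K}(I*\{x\}).$$
   Context: All topologies are Hausdorff. For a locally compact Hausdorff space $X$: $M(X)$ is the space of regular complex Borel measures on $X$; $M^+(X)$ is the set of finite non-negative regular Borel measures, with the cone topology (the weakest topology making $\mu\mapsto\int_X f\,d\mu$ continuous for every $f\in C_c^+(X)\cup\{1_X\}$, where $C_c^+(X)$ is the set of non-negative compactly supported continuous functions and $1_X$ is the constant function $1$); $\mathfrak{C}(X)$ is the set of compact subsets of $X$ with the Michael topology, generated by the sub-basis of sets $\{C\in\mathfrak{C}(X): C\cap U\neq\emptyset,\ C\subset V\}$ for $U,V$ open in $X$; $p_x$ is the point mass at $x$. A semitopological semihypergroup is a pair $(K,* )$ such that: (A1) $K$ is a locally compact Hausdorff space and $*$ is a binary operation making $M(K)$ an associative algebra; (A2) $*$ sends $M^+(K)\times M^+(K)$ into $M^+(K)$ and for each $\omega\in M^+(K)$ both maps $\mu\mapsto\omega*\mu$ and $\mu\mapsto\mu*\omega$ from $M^+(K)$ to $M^+(K)$ are continuous; (A3) for all $x,y\in K$, $p_x*p_y$ is a probability measure with compact support; (A4) the map $(x,y)\mapsto \mathrm{supp}(p_x*p_y)$, $K\times K\to\mathfrak{C}(K)$, is continuous. It is compact if $K$ is compact. For $A,B\subset K$, $A*B:=\bigcup_{x\in A,\,y\in B}\mathrm{supp}(p_x*p_y)$. A left ideal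 is a set $I\subset K$ with $(p_x*p_a)(I)=1$ for all $x\in K$, $a\in I$; a right ideal is a set $I\subset K$ with $(p_a*p_x)(I)=1$ for all $x\in K$, $a\in I$; an ideal is a set that is both. All ideals are assumed closed and non-empty; so a closed non-empty $I$ is a left ideal iff $\mathrm{supp}(p_x*p_a)\subset I$ for all $x\in K$, $a\in I$. A left ideal is minimal if it contains no proper left ideal of $K$. $\mathcal{L}(K)$ is the set of all minimal left ideals of $K$. $\mathrm{Ker}(K)$ is the intersection of all (two-sided) ideals of $K$. *)

theory Defs
  imports "HOL-Analysis.Analysis"
begin

text \<open>
  The underlying space is a Hausdorff type. A complex Borel measure is a set function that is
  countably additive on the Borel sets; it is required to vanish on all other sets, so that
  equality of measures is equality of functions. Sums and scalar multiples are taken pointwise.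
\<close>

definition complex_borel_measure :: "('a::topological_space set \<Rightarrow> complex) \<Rightarrow> bool" where
  "complex_borel_measure \<mu> \<longleftrightarrow>
     (\<forall>A. A \<notin> sets borel \<longrightarrow> \<mu> A = 0) \<and>
     (\<forall>A::nat \<Rightarrow> 'a set. range A \<subseteq> sets borel \<longrightarrow> disjoint_family A \<longrightarrow>
        (\<lambda>i. \<mu> (A i)) sums \<mu> (\<Union>i. A i))"

definition total_variation :: "('a::topological_space set \<Rightarrow> complex) \<Rightarrow> 'a set \<Rightarrow> ennreal" where
  "total_variation \<mu> E =
     (SUP D\<in>{D::nat \<Rightarrow> 'a set. range D \<subseteq> sets borel \<and> disjoint_family D \<and> (\<Union>i. D i) = E}.
        \<Sum>i. ennreal (cmod (\<mu> (D i))))"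

definition regular_measure :: "('a::topological_space set \<Rightarrow> complex) \<Rightarrow> bool" where
  "regular_measure \<mu> \<longleftrightarrow>
     (\<forall>E\<in>sets borel.
        total_variation \<mu> E = (INF U\<in>{U. open U \<and> E \<subseteq> U}. total_variation \<mu> U) \<and>
        total_variation \<mu> E = (SUP C\<in>{C. compact C \<and> C \<subseteq> E}. total_variation \<mu> C))"

definition meas_space :: "('a::topological_space set \<Rightarrow> complex) set" where
  "meas_space = {\<mu>. complex_borel_measure \<mu> \<and> regular_measure \<mu>}"

text \<open>The finite non-negative regular Borel measures are identified with the elements of
  \<^const>\<open>meas_space\<close> whose values are non-negative reals.\<close>

definition pos_meas_space :: "('a::topological_space set \<Rightarrow> complex) set" where
  "pos_meas_space = {\<mu> \<in> meas_space. \<forall>A\<in>sets borel. \<mu> A \<in> \<real>\<^sub>\<ge>\<^sub>0}"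

text \<open>The library measure belonging to an element of \<^const>\<open>pos_meas_space\<close>, used for integration.\<close>

definition to_measure :: "('a::topological_space set \<Rightarrow> complex) \<Rightarrow> 'a measure" where
  "to_measure \<mu> = measure_of UNIV (sets borel) (\<lambda>A. ennreal (Re (\<mu> A)))"

definition point_mass :: "'a::topological_space \<Rightarrow> 'a set \<Rightarrow> complex" where
  "point_mass x A = (if A \<in> sets borel \<and> x \<in> A then 1 else 0)"

definition meas_supp :: "('a::topological_space set \<Rightarrow> complex) \<Rightarrow> 'a set" where
  "meas_supp \<mu> = {x. \<forall>U. open U \<and> x \<in> U \<longrightarrow> total_variation \<mu> U > 0}"

definition Cc_pos :: "('a::topological_space \<Rightarrow> real) set" where
  "Cc_pos = {f. continuous_on UNIV f \<and> (\<forall>x. 0 \<le> f x) \<and> compact (closure {x. f x \<noteq> 0})}"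

definition cone_topology :: "('a::topological_space set \<Rightarrow> complex) topology" where
  "cone_topology = topology_generated_by
     {{\<mu> \<in> pos_meas_space. (\<integral>x. f x \<partial>to_measure \<mu>) \<in> V} |f V.
        f \<in> Cc_pos \<union> {\<lambda>x. 1} \<and> open V}"

text \<open>The topology of \<^const>\<open>topology_generated_by\<close> has the union of the sub-basis as carrier. The
  family of all compact sets is inserted because the other members omit the empty set.\<close>

definition michael_topology :: "'a::topological_space set topology" where
  "michael_topology = topology_generated_by
     (insert {C. compact C}
        {{C. compact C \<and> C \<inter> U \<noteq> {} \<and> C \<subseteq> V} |U V. open U \<and> open V})"

locale semitopological_semihypergroup =
  fixes conv :: "('a::t2_space set \<Rightarrow> complex) \<Rightarrow> ('a set \<Rightarrow> complex) \<Rightarrow> ('a set \<Rightarrow> complex)"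
  assumes locally_compact: "locally_compact_space (euclidean :: 'a topology)"
    and conv_closed: "\<mu> \<in> meas_space \<Longrightarrow> \<nu> \<in> meas_space \<Longrightarrow> conv \<mu> \<nu> \<in> meas_space"
    and conv_assoc:
      "\<mu> \<in> meas_space \<Longrightarrow> \<nu> \<in> meas_space \<Longrightarrow> \<rho> \<in> meas_space \<Longrightarrow>
       conv (conv \<mu> \<nu>) \<rho> = conv \<mu> (conv \<nu> \<rho>)"
    and conv_add_left:
      "\<mu> \<in> meas_space \<Longrightarrow> \<nu> \<in> meas_space \<Longrightarrow> \<rho> \<in> meas_space \<Longrightarrow>
       conv (\<lambda>A. \<mu> A + \<nu> A) \<rho> = (\<lambda>A. conv \<mu> \<rho> A + conv \<nu> \<rho> A)"
    and conv_add_right: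
      "\<mu> \<in> meas_space \<Longrightarrow> \<nu> \<in> meas_space \<Longrightarrow> \<rho> \<in> meas_space \<Longrightarrow>
       conv \<rho> (\<lambda>A. \<mu> A + \<nu> A) = (\<lambda>A. conv \<rho> \<mu> A + conv \<rho> \<nu> A)"
    and conv_scale_left:
      "\<mu> \<in> meas_space \<Longrightarrow> \<nu> \<in> meas_space \<Longrightarrow> conv (\<lambda>A. c * \<mu> A) \<nu> = (\<lambda>A. c * conv \<mu> \<nu> A)"
    and conv_scale_right:
      "\<mu> \<in> meas_space \<Longrightarrow> \<nu> \<in> meas_space \<Longrightarrow> conv \<mu> (\<lambda>A. c * \<nu> A) = (\<lambda>A. c * conv \<mu> \<nu> A)"
    and conv_pos: "\<mu> \<in> pos_meas_space \<Longrightarrow> \<nu> \<in> pos_meas_space \<Longrightarrow> conv \<mu> \<nu> \<in> pos_meas_space"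
    and continuous_left:
      "\<omega> \<in> pos_meas_space \<Longrightarrow> continuous_map cone_topology cone_topology (\<lambda>\<mu>. conv \<omega> \<mu>)"
    and continuous_right:
      "\<omega> \<in> pos_meas_space \<Longrightarrow> continuous_map cone_topology cone_topology (\<lambda>\<mu>. conv \<mu> \<omega>)"
    and conv_point_pos: "conv (point_mass x) (point_mass y) \<in> pos_meas_space"
    and conv_point_prob: "conv (point_mass x) (point_mass y) UNIV = 1"
    and compact_supp: "compact (meas_supp (conv (point_mass x) (point_mass y)))"
    and continuous_supp:
      "continuous_map (prod_topology euclidean euclidean) michael_topology
         (\<lambda>(x, y). meas_supp (conv (point_mass x) (point_mass y)))"

definition set_conv ::
    "(('a::topological_space set \<Rightarrow> complex) \<Rightarrow> ('a set \<Rightarrow> complex) \<Rightarrow> ('a set \<Rightarrow> complex)) \<Rightarrow>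
     'a set \<Rightarrow> 'a set \<Rightarrow> 'a set" where
  "set_conv conv A B = (\<Union>x\<in>A. \<Union>y\<in>B. meas_supp (conv (point_mass x) (point_mass y)))"

definition left_ideal ::
    "(('a::topological_space set \<Rightarrow> complex) \<Rightarrow> ('a set \<Rightarrow> complex) \<Rightarrow> ('a set \<Rightarrow> complex)) \<Rightarrow>
     'a set \<Rightarrow> bool" where
  "left_ideal conv I \<longleftrightarrow>
     closed I \<and> I \<noteq> {} \<and> (\<forall>x. \<forall>a\<in>I. conv (point_mass x) (point_mass a) I = 1)"

definition right_ideal ::
    "(('a::topological_space set \<Rightarrow> complex) \<Rightarrow> ('a set \<Rightarrow> complex) \<Rightarrow> ('a set \<Rightarrow> complex)) \<Rightarrow>
     'a set \<Rightarrow> bool" where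
  "right_ideal conv I \<longleftrightarrow>
     closed I \<and> I \<noteq> {} \<and> (\<forall>x. \<forall>a\<in>I. conv (point_mass a) (point_mass x) I = 1)"

definition two_sided_ideal ::
    "(('a::topological_space set \<Rightarrow> complex) \<Rightarrow> ('a set \<Rightarrow> complex) \<Rightarrow> ('a set \<Rightarrow> complex)) \<Rightarrow>
     'a set \<Rightarrow> bool" where
  "two_sided_ideal conv I \<longleftrightarrow> left_ideal conv I \<and> right_ideal conv I"

definition minimal_left_ideals ::
    "(('a::topological_space set \<Rightarrow> complex) \<Rightarrow> ('a set \<Rightarrow> complex) \<Rightarrow> ('a set \<Rightarrow> complex)) \<Rightarrow>
     'a set set" where
  "minimal_left_ideals conv =
     {I. left_ideal conv I \<and> (\<forall>J. left_ideal conv J \<and> J \<subseteq> I \<longrightarrow> J = I)}"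

definition Ker ::
    "(('a::topological_space set \<Rightarrow> complex) \<Rightarrow> ('a set \<Rightarrow> complex) \<Rightarrow> ('a set \<Rightarrow> complex)) \<Rightarrow>
     'a set" where
  "Ker conv = \<Inter>{J. two_sided_ideal conv J}"

end

theory Submission
  imports Defs
begin

text \<open>
  A minimal left ideal \<open>M\<close> lies in every two-sided ideal \<open>J\<close>: multiplying an element of \<open>J\<close> by an
  element of \<open>M\<close> gives a support inside \<open>J \<inter> M\<close>, so \<open>J \<inter> M\<close> is a left ideal contained in \<open>M\<close> and
  minimality makes it equal to \<open>M\<close>. This is the first inclusion.

  For the second inclusion, it suffices that \<open>I * K\<close> is itself a two-sided ideal, because the kernel
  is contained in each of those. It is closed, with no closure taken, because a Michael-continuous
  family of compact sets over the compact set \<open>I \<times> K\<close> has compact union. That it absorbs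
  multiplication on both sides comes from associativity, \<open>x * (a * y) = (x * a) * y\<close> and
  \<open>(a * y) * x = a * (y * x)\<close>, once supports of products of measures are
  determined by supports of products of points: for \<open>C\<close> closed, the support of
  \<open>\<mu> * \<nu>\<close> lies in \<open>C\<close> if and only if that of \<open>p\<^sub>b * \<nu>\<close> does for every \<open>b\<close> in the support of \<open>\<mu>\<close>,
  and likewise in the other factor.

  This equivalence is the analytic core. The support of a positive regular
  measure lies in \<open>C\<close> exactly when the measure annihilates every non-negative continuous function
  vanishing on \<open>C\<close>. For such an \<open>f\<close>, the functional \<open>T \<mu> = \<integral> f d(\<mu> * \<nu>)\<close> on positive measures is
  additive, positively homogeneous and continuous in the cone topology, so it must be
  integration of the continuous function \<open>b \<mapsto> T p\<^sub>b\<close>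
  (\<open>cone_linear_continuous_representation\<close>): both sides agree on finite combinations of
  point masses, and these are dense. Hence \<open>T \<mu> = 0\<close> if and only if \<open>T p\<^sub>b = 0\<close> on the support of \<open>\<mu>\<close>.
\<close>

section \<open>Positive regular measures\<close>

abbreviation integ :: "('a::topological_space set \<Rightarrow> complex) \<Rightarrow> ('a \<Rightarrow> real) \<Rightarrow> real" where
  "integ \<mu> f \<equiv> \<integral>x. f x \<partial>to_measure \<mu>"

lemma pos_Re:
  assumes "\<mu> \<in> pos_meas_space"
  shows "0 \<le> Re (\<mu> A)" and "\<mu> A = complex_of_real (Re (\<mu> A))"
proof -
  have "\<mu> A \<in> \<real>\<^sub>\<ge>\<^sub>0"
  proof (cases "A \<in> sets borel")
    case True then show ?thesis using assms by (auto simp: pos_meas_space_def)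
  next
    case False then show ?thesis using assms
      by (auto simp: pos_meas_space_def meas_space_def complex_borel_measure_def)
  qed
  then show "0 \<le> Re (\<mu> A)" "\<mu> A = complex_of_real (Re (\<mu> A))"
    by (auto simp: complex_nonneg_Reals_iff complex_eq_iff)
qed

lemma space_to_measure [simp]: "space (to_measure \<mu>) = UNIV"
  and sets_to_measure [simp, measurable_cong]: "sets (to_measure \<mu>) = sets borel"
proof -
  have s: "sigma_sets UNIV (sets borel) = (sets borel :: 'a set set)"
    using sets.sigma_sets_eq[of "borel :: 'a measure"] by simp
  show "space (to_measure \<mu>) = UNIV" "sets (to_measure \<mu>) = sets borel"
    by (simp_all add: to_measure_def sets_measure_of_conv space_measure_of_conv s)
qed

lemma emeasure_to_measure:
  assumes \<mu>: "\<mu> \<in> pos_meas_space" and A: "A \<in> sets borel"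
  shows "emeasure (to_measure \<mu>) A = ennreal (Re (\<mu> A))"
proof -
  have cb: "complex_borel_measure \<mu>" using \<mu> by (auto simp: pos_meas_space_def meas_space_def)
  have sums: "(\<lambda>i. \<mu> (D i)) sums \<mu> (\<Union>i. D i)"
    if "range D \<subseteq> sets borel" "disjoint_family D" for D :: "nat \<Rightarrow> _"
    using cb that by (auto simp: complex_borel_measure_def)
  \<comment> \<open>A constant summable series vanishes.\<close>
  have "(\<lambda>i::nat. \<mu> {}) sums \<mu> {}" using sums[of "\<lambda>_. {}"] by (simp add: disjoint_family_on_def)
  then have e: "\<mu> {} = 0" by (auto dest!: sums_summable simp: summable_const_iff)
  show ?thesis unfolding to_measure_def
  proof (rule emeasure_measure_of_sigma)
    show "sigma_algebra UNIV (sets (borel :: 'a measure))"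
      using sets.sigma_algebra_axioms[of "borel :: 'a measure"] by simp
    show "positive (sets borel) (\<lambda>A. ennreal (Re (\<mu> A)))" by (simp add: positive_def e)
    show "countably_additive (sets borel) (\<lambda>A. ennreal (Re (\<mu> A)))"
    proof (rule countably_additiveI)
      fix D :: "nat \<Rightarrow> 'a set" assume "range D \<subseteq> sets borel" "disjoint_family D"
      from sums[OF this] have "(\<lambda>i. Re (\<mu> (D i))) sums Re (\<mu> (\<Union>i. D i))" by (rule sums_Re)
      then show "(\<Sum>i. ennreal (Re (\<mu> (D i)))) = ennreal (Re (\<mu> (\<Union>i. D i)))"
        using pos_Re(1)[OF \<mu>] by (simp add: suminf_ennreal2 sums_iff)
    qed
  qed (rule A)
qed

lemma measure_to_measure:
  "\<mu> \<in> pos_meas_space \<Longrightarrow> A \<in> sets borel \<Longrightarrow> measure (to_measure \<mu>) A = Re (\<mu> A)"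
  by (simp add: measure_def emeasure_to_measure pos_Re(1))

lemma finite_to_measure: "\<mu> \<in> pos_meas_space \<Longrightarrow> finite_measure (to_measure \<mu>)"
  by (rule finite_measureI) (simp add: emeasure_to_measure)

text \<open>
  If the moduli are already countably additive, every partition of \<open>E\<close> attains the supremum.
  The assumption is phrased for set functions, so that the lemma can be
  applied before membership in \<^const>\<open>pos_meas_space\<close> is known.
\<close>
lemma total_variation_nonneg:
  fixes \<mu> :: "'a::topological_space set \<Rightarrow> complex"
  assumes add: "\<And>D::nat \<Rightarrow> 'a set. range D \<subseteq> sets borel \<Longrightarrow> disjoint_family D \<Longrightarrow>
      (\<Sum>i. ennreal (cmod (\<mu> (D i)))) = ennreal (cmod (\<mu> (\<Union>i. D i)))"
    and E: "E \<in> sets borel"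
  shows "total_variation \<mu> E = ennreal (cmod (\<mu> E))"
proof -
  let ?P = "{D::nat \<Rightarrow> 'a set. range D \<subseteq> sets borel \<and> disjoint_family D \<and> (\<Union>i. D i) = E}"
  have "(\<lambda>i::nat. if i = 0 then E else {}) \<in> ?P"
    using E by (auto simp: disjoint_family_on_def split: if_splits)
  then have ne: "?P \<noteq> {}" by blast
  have "(\<Sum>i. ennreal (cmod (\<mu> (D i)))) = ennreal (cmod (\<mu> E))" if "D \<in> ?P" for D
  proof -
    have D: "range D \<subseteq> sets borel" "disjoint_family D" "(\<Union>i. D i) = E" using that by blast+
    show ?thesis using add[OF D(1,2)] unfolding D(3) .
  qed
  then have "total_variation \<mu> E = (SUP D\<in>?P. ennreal (cmod (\<mu> E)))"
    unfolding total_variation_def by (rule SUP_cong[OF refl])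
  then show ?thesis using ne by simp
qed

lemma total_variation_pos:
  assumes \<mu>: "\<mu> \<in> pos_meas_space" and E: "E \<in> sets borel"
  shows "total_variation \<mu> E = emeasure (to_measure \<mu>) E"
proof -
  have c: "cmod (\<mu> A) = Re (\<mu> A)" for A
    using pos_Re[OF \<mu>, of A] by (metis norm_of_real abs_of_nonneg)
  have "total_variation \<mu> E = ennreal (cmod (\<mu> E))"
  proof (rule total_variation_nonneg[OF _ E])
    fix D :: "nat \<Rightarrow> 'a set" assume D: "range D \<subseteq> sets borel" "disjoint_family D"
    then have "(\<Sum>i. emeasure (to_measure \<mu>) (D i)) = emeasure (to_measure \<mu>) (\<Union>i. D i)"
      by (intro suminf_emeasure) auto
    moreover have "D i \<in> sets borel" for i using D by auto
    moreover have "(\<Union>i. D i) \<in> sets borel" using D by auto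
    ultimately show "(\<Sum>i. ennreal (cmod (\<mu> (D i)))) = ennreal (cmod (\<mu> (\<Union>i. D i)))"
      by (simp add: c emeasure_to_measure \<mu>)
  qed
  then show ?thesis by (simp add: c emeasure_to_measure \<mu> E)
qed

section \<open>Finite combinations of point masses\<close>
definition atomic_measure :: "('a::topological_space \<Rightarrow> real) \<Rightarrow> 'a set \<Rightarrow> 'a set \<Rightarrow> complex" where
  "atomic_measure c S A = (if A \<in> sets borel then complex_of_real (\<Sum>b\<in>S \<inter> A. c b) else 0)"

text \<open>
  Regularity needs no approximation here: removing from the whole space the finitely many
  atoms outside \<open>E\<close> gives an open set of the same mass as \<open>E\<close>, and the atoms inside \<open>E\<close> form a compact
  set of that mass.
\<close>
lemma atomic_measure_pos:
  fixes S :: "'a::t2_space set"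
  assumes S: "finite S" and c: "\<And>b. 0 \<le> c b"
  shows "atomic_measure c S \<in> pos_meas_space"
proof -
  have sums: "(\<lambda>i. \<Sum>b\<in>S \<inter> D i. c b) sums (\<Sum>b\<in>S \<inter> (\<Union>i. D i). c b)"
    if D: "disjoint_family D" for D :: "nat \<Rightarrow> 'a set"
  proof -
    have "(\<lambda>i. \<Sum>b\<in>S. if b \<in> D i then c b else 0) sums
        (\<Sum>b\<in>S. if b \<in> (\<Union>i. D i) then c b else 0)"
    proof (rule sums_sum)
      fix b
      show "(\<lambda>i. if b \<in> D i then c b else 0) sums (if b \<in> (\<Union>i. D i) then c b else 0)"
      proof (cases "b \<in> (\<Union>i. D i)")
        case True
        then obtain j where j: "b \<in> D j" by auto
        have "b \<in> D i \<longleftrightarrow> i = j" for i using D j unfolding disjoint_family_on_def by blast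
        then have "(\<lambda>i. if b \<in> D i then c b else 0) = (\<lambda>i. if i = j then c b else 0)"
          by simp
        then show ?thesis using True sums_single[of j "\<lambda>_. c b"] by simp
      next
        case False then show ?thesis by simp
      qed
    qed
    then show ?thesis by (simp only: sum.inter_restrict[OF S])
  qed
  have cm: "cmod (atomic_measure c S A) = (\<Sum>b\<in>S \<inter> A. c b)" if "A \<in> sets borel" for A
    using that by (simp add: atomic_measure_def sum_nonneg c del: of_real_sum)
  have cb: "complex_borel_measure (atomic_measure c S)"
    unfolding complex_borel_measure_def
  proof (intro conjI allI impI)
    fix D :: "nat \<Rightarrow> 'a set" assume D: "range D \<subseteq> sets borel" "disjoint_family D"
    then have "D i \<in> sets borel" "(\<Union>i. D i) \<in> sets borel" for i by auto
    then show "(\<lambda>i. atomic_measure c S (D i)) sums atomic_measure c S (\<Union>i. D i)"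
      using sums_of_real[OF sums[OF D(2)]] by (simp add: atomic_measure_def)
  qed (simp add: atomic_measure_def)
  have tv: "total_variation (atomic_measure c S) E = ennreal (\<Sum>b\<in>S \<inter> E. c b)"
    if E: "E \<in> sets borel" for E
    unfolding cm[OF E, symmetric]
  proof (rule total_variation_nonneg[OF _ E])
    fix D :: "nat \<Rightarrow> 'a set" assume D: "range D \<subseteq> sets borel" "disjoint_family D"
    then have m: "D i \<in> sets borel" "(\<Union>i. D i) \<in> sets borel" for i by auto
    show "(\<Sum>i. ennreal (cmod (atomic_measure c S (D i)))) = ennreal (cmod (atomic_measure c S (\<Union>i. D i)))"
      using sums[OF D(2)] by (simp add: cm m suminf_ennreal2 sum_nonneg c sums_iff)
  qed
  have mono: "total_variation (atomic_measure c S) E \<le> total_variation (atomic_measure c S) E'"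
    if "E \<subseteq> E'" "E \<in> sets borel" "E' \<in> sets borel" for E E'
    using that S by (auto simp: tv c intro!: ennreal_leI sum_mono2)
  have "regular_measure (atomic_measure c S)"
    unfolding regular_measure_def
  proof (intro ballI conjI)
    fix E :: "'a set" assume E: "E \<in> sets borel"
    have o: "open (- (S - E))" "E \<subseteq> - (S - E)" "S \<inter> - (S - E) = S \<inter> E"
      using S by (intro open_Compl finite_imp_closed; blast) blast+
    have k: "compact (S \<inter> E)" using S by (simp add: finite_imp_compact)
    show "total_variation (atomic_measure c S) E
        = (INF U\<in>{U. open U \<and> E \<subseteq> U}. total_variation (atomic_measure c S) U)"
    proof (rule antisym)
      show "total_variation (atomic_measure c S) E
          \<le> (INF U\<in>{U. open U \<and> E \<subseteq> U}. total_variation (atomic_measure c S) U)"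
        by (rule INF_greatest) (use E in \<open>auto intro: mono\<close>)
      have "total_variation (atomic_measure c S) (- (S - E)) = total_variation (atomic_measure c S) E"
        using tv[OF E] tv[of "- (S - E)"] o by simp
      then show "(INF U\<in>{U. open U \<and> E \<subseteq> U}. total_variation (atomic_measure c S) U)
          \<le> total_variation (atomic_measure c S) E"
        using o by (intro INF_lower2[of "- (S - E)"]) auto
    qed
    show "total_variation (atomic_measure c S) E
        = (SUP C\<in>{C. compact C \<and> C \<subseteq> E}. total_variation (atomic_measure c S) C)"
    proof (rule antisym)
      show "(SUP C\<in>{C. compact C \<and> C \<subseteq> E}. total_variation (atomic_measure c S) C)
          \<le> total_variation (atomic_measure c S) E"
        by (rule SUP_least) (use E in \<open>auto intro!: mono borel_closed compact_imp_closed\<close>)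
      have "total_variation (atomic_measure c S) (S \<inter> E) = total_variation (atomic_measure c S) E"
        using tv[OF E] tv[of "S \<inter> E"] k by (simp add: compact_imp_closed)
      then show "total_variation (atomic_measure c S) E
          \<le> (SUP C\<in>{C. compact C \<and> C \<subseteq> E}. total_variation (atomic_measure c S) C)"
        using k by (intro SUP_upper2[of "S \<inter> E"]) auto
    qed
  qed
  then show ?thesis using cb c
    by (auto simp: pos_meas_space_def meas_space_def atomic_measure_def complex_nonneg_Reals_iff sum_nonneg)
qed

lemma point_mass_atomic: "point_mass x = atomic_measure (\<lambda>_. 1) {x}"
  by (rule ext) (auto simp: point_mass_def atomic_measure_def)

lemma point_mass_pos: "point_mass (x::'a::t2_space) \<in> pos_meas_space"
  unfolding point_mass_atomic by (rule atomic_measure_pos) auto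

section \<open>Additive functionals on the cone of positive measures\<close>

text \<open>
  Membership of sums and multiples in the cone is a premise: it is at hand wherever the property
  is applied, and having it as a premise saves a proof that regularity is preserved under addition.
\<close>
definition cone_linear :: "(('a::t2_space set \<Rightarrow> complex) \<Rightarrow> real) \<Rightarrow> bool" where
  "cone_linear T \<longleftrightarrow>
     (\<forall>\<mu>\<in>pos_meas_space. \<forall>\<nu>\<in>pos_meas_space.
        (\<lambda>A. \<mu> A + \<nu> A) \<in> pos_meas_space \<longrightarrow> T (\<lambda>A. \<mu> A + \<nu> A) = T \<mu> + T \<nu>) \<and>
     (\<forall>\<mu>\<in>pos_meas_space. \<forall>c\<ge>0.
        (\<lambda>A. complex_of_real c * \<mu> A) \<in> pos_meas_space \<longrightarrow> T (\<lambda>A. complex_of_real c * \<mu> A) = c * T \<mu>)"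

lemma cone_linear_atomic:
  fixes S :: "'a::t2_space set"
  assumes T: "cone_linear T" and S: "finite S" and c: "\<And>b. 0 \<le> c b"
  shows "T (atomic_measure c S) = (\<Sum>b\<in>S. c b * T (point_mass b))"
proof -
  have one: "T (atomic_measure c {b}) = c b * T (point_mass b)" for b
  proof -
    have "atomic_measure c {b} = (\<lambda>A. complex_of_real (c b) * point_mass b A)"
      by (rule ext) (auto simp: point_mass_def atomic_measure_def)
    moreover have "atomic_measure c {b} \<in> pos_meas_space" by (rule atomic_measure_pos) (auto simp: c)
    ultimately show ?thesis using T c[of b] by (simp add: cone_linear_def point_mass_pos)
  qed
  have zero: "T (atomic_measure c {}) = 0"
  proof -
    have *: "atomic_measure c {} = (\<lambda>A::'a set. complex_of_real 0 * point_mass (undefined::'a) A)"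
      by (rule ext) (auto simp: atomic_measure_def)
    moreover have "atomic_measure c {} \<in> pos_meas_space" by (rule atomic_measure_pos) (auto simp: c)
    ultimately have "T (atomic_measure c {}) = 0 * T (point_mass undefined)"
      using T unfolding cone_linear_def by (metis order_refl point_mass_pos)
    then show ?thesis by simp
  qed
  show ?thesis using S
  proof induction
    case (insert b S)
    have "atomic_measure c (insert b S) = (\<lambda>A. atomic_measure c {b} A + atomic_measure c S A)"
    proof
      fix A
      have "(\<Sum>a\<in>insert b S \<inter> A. c a) = (\<Sum>a\<in>{b} \<inter> A. c a) + (\<Sum>a\<in>S \<inter> A. c a)"
        using insert.hyps by (subst sum.union_disjoint[symmetric]) (auto intro!: sum.cong)
      then show "atomic_measure c (insert b S) A = atomic_measure c {b} A + atomic_measure c S A"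
        by (simp add: atomic_measure_def)
    qed
    moreover have "atomic_measure c (insert b S) \<in> pos_meas_space" "atomic_measure c {b} \<in> pos_meas_space"
        "atomic_measure c S \<in> pos_meas_space"
      using insert.hyps by (auto intro!: atomic_measure_pos simp: c)
    ultimately have "T (atomic_measure c (insert b S)) = T (atomic_measure c {b}) + T (atomic_measure c S)"
      using T by (simp add: cone_linear_def)
    then show ?case using insert by (simp add: one)
  qed (simp add: zero)
qed

lemma integ_const: "\<mu> \<in> pos_meas_space \<Longrightarrow> integ \<mu> (\<lambda>_. k) = Re (\<mu> UNIV) * k"
  by (simp add: measure_to_measure)

text \<open>
  Integration is linear in the measure: this is clear for indicator functions and
  passes to non-negative Borel functions by monotone approximation. Additivity and homogeneity
  are treated together as one statement about \<open>\<rho> = p \<mu> + q \<nu>\<close>.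
\<close>
lemma cone_linear_integ:
  fixes f :: "'a::t2_space \<Rightarrow> real"
  assumes f: "f \<in> borel_measurable borel" "\<And>x. 0 \<le> f x" "\<And>x. f x \<le> B"
  shows "cone_linear (\<lambda>\<mu>. integ \<mu> f)"
proof -
  define N :: "('a set \<Rightarrow> complex) \<Rightarrow> ('a \<Rightarrow> ennreal) \<Rightarrow> ennreal"
    where "N \<mu> g = (\<integral>\<^sup>+x. g x \<partial>to_measure \<mu>)" for \<mu> g
  have I: "ennreal (integ \<mu> f) = N \<mu> (\<lambda>x. ennreal (f x))" and I0: "0 \<le> integ \<mu> f"
    if "\<mu> \<in> pos_meas_space" for \<mu>
  proof -
    interpret finite_measure "to_measure \<mu>" by (rule finite_to_measure[OF that])
    have "integrable (to_measure \<mu>) f"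
      using f by (intro integrable_const_bound[where B=B]) auto
    then show "ennreal (integ \<mu> f) = N \<mu> (\<lambda>x. ennreal (f x))"
      unfolding N_def using f(2) by (intro nn_integral_eq_integral[symmetric]) auto
    show "0 \<le> integ \<mu> f" using f(2) by (intro integral_nonneg_AE) auto
  qed
  have g: "(\<lambda>x. ennreal (f x)) \<in> borel_measurable borel" using f(1) by measurable
  have cone: "N \<rho> g = ennreal p * N \<mu> g + ennreal q * N \<nu> g"
    if pos: "\<mu> \<in> pos_meas_space" "\<nu> \<in> pos_meas_space" "\<rho> \<in> pos_meas_space" "0 \<le> p" "0 \<le> q"
      and \<rho>: "\<And>A. Re (\<rho> A) = p * Re (\<mu> A) + q * Re (\<nu> A)" and g: "g \<in> borel_measurable borel"
    for \<mu> \<nu> \<rho> p q g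
    using g
  proof (induction rule: borel_measurable_induct)
    case (cong f g) then show ?case by (simp add: N_def)
  next
    case (set A)
    then show ?case using pos pos_Re(1)[of \<mu> A] pos_Re(1)[of \<nu> A]
      by (simp add: N_def emeasure_to_measure \<rho> ennreal_mult ennreal_plus)
  next
    case (mult u c)
    then show ?case by (simp add: N_def nn_integral_cmult measurable_def distrib_left mult.left_commute)
  next
    case (add u v)
    then show ?case by (simp add: N_def nn_integral_add distrib_left add.assoc add.left_commute)
  next
    case (seq U)
    have *: "N \<mu> (SUP i. U i) = (SUP i. N \<mu> (U i))" for \<mu>
      unfolding N_def using seq
      by (simp add: nn_integral_monotone_convergence_SUP[symmetric] SUP_apply[abs_def])
    have inc: "incseq (\<lambda>i. N \<mu> (U i))" for \<mu>
      using seq(3) unfolding N_def by (auto simp: incseq_def le_fun_def intro!: nn_integral_mono)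
    have inc': "incseq (\<lambda>i. ennreal p * N \<mu> (U i))" for \<mu> p
      using inc[of \<mu>] by (auto simp: incseq_def intro: mult_left_mono)
    show ?case unfolding * SUP_mult_left_ennreal
      by (subst ennreal_SUP_add[symmetric, OF inc' inc']) (simp add: seq)
  qed
  show ?thesis unfolding cone_linear_def
  proof (intro conjI ballI allI impI)
    fix \<mu> \<nu> :: "'a set \<Rightarrow> complex"
    assume pos: "\<mu> \<in> pos_meas_space" "\<nu> \<in> pos_meas_space" "(\<lambda>A. \<mu> A + \<nu> A) \<in> pos_meas_space"
    have "ennreal (integ (\<lambda>A. \<mu> A + \<nu> A) f) = ennreal (integ \<mu> f + integ \<nu> f)"
      using cone[OF pos, of 1 1, OF _ _ _ g] by (simp add: I pos I0 ennreal_plus)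
    then show "integ (\<lambda>A. \<mu> A + \<nu> A) f = integ \<mu> f + integ \<nu> f"
      by (simp add: I0 pos del: ennreal_plus)
  next
    fix \<mu> :: "'a set \<Rightarrow> complex" and c :: real
    assume pos: "\<mu> \<in> pos_meas_space" "(\<lambda>A. complex_of_real c * \<mu> A) \<in> pos_meas_space" and c: "0 \<le> c"
    have "ennreal (integ (\<lambda>A. complex_of_real c * \<mu> A) f) = ennreal (c * integ \<mu> f)"
      using cone[OF pos(1) pos(1) pos(2), of c 0, OF _ _ _ g] c by (simp add: I pos I0 ennreal_mult)
    then show "integ (\<lambda>A. complex_of_real c * \<mu> A) f = c * integ \<mu> f" by (simp add: I0 pos c)
  qed
qed


section \<open>The cone topology over a compact space\<close>
lemma Cc_posI:
  fixes f :: "'a::t2_space \<Rightarrow> real"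
  assumes "compact (UNIV :: 'a set)" "continuous_on UNIV f" "\<And>x. 0 \<le> f x"
  shows "f \<in> Cc_pos"
  using assms compact_Int_closed[OF assms(1), of "closure {x. f x \<noteq> 0}"] by (simp add: Cc_pos_def)

lemma continuous_bounded:
  fixes f :: "'a::t2_space \<Rightarrow> real"
  assumes "compact (UNIV :: 'a set)" "continuous_on UNIV f"
  obtains B where "\<And>x. \<bar>f x\<bar> \<le> B"
proof -
  have "bounded (range f)" using assms compact_continuous_image compact_imp_bounded by blast
  then show thesis using that by (auto simp: bounded_iff)
qed

lemma integrable_continuous_pos:
  fixes f :: "'a::t2_space \<Rightarrow> real"
  assumes K: "compact (UNIV :: 'a set)" and f: "continuous_on UNIV f" and \<mu>: "\<mu> \<in> pos_meas_space"
  shows "integrable (to_measure \<mu>) f"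
proof -
  obtain B where B: "\<And>x. \<bar>f x\<bar> \<le> B" using continuous_bounded[OF K f] by blast
  interpret finite_measure "to_measure \<mu>" by (rule finite_to_measure[OF \<mu>])
  show ?thesis
    using borel_measurable_continuous_onI[OF f] B by (intro integrable_const_bound[where B=B]) auto
qed

lemma topspace_cone [simp]: "topspace cone_topology = pos_meas_space"
proof -
  have "pos_meas_space \<in> {{\<mu> \<in> pos_meas_space. integ \<mu> f \<in> V} |f V. f \<in> Cc_pos \<union> {\<lambda>x. 1} \<and> open V}"
    by (intro CollectI exI[of _ "\<lambda>_. 1"] exI[of _ UNIV]) auto
  then show ?thesis unfolding cone_topology_def topology_generated_by_topspace by blast
qed

lemma continuous_integ:
  assumes "f \<in> Cc_pos \<union> {\<lambda>x. 1}"
  shows "continuous_map cone_topology euclidean (\<lambda>\<mu>. integ \<mu> f)"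
  unfolding continuous_map_def
proof (intro conjI allI impI)
  fix V :: "real set" assume "openin euclidean V"
  then have V: "open V" by simp
  show "openin cone_topology {\<mu> \<in> topspace cone_topology. integ \<mu> f \<in> V}"
    unfolding topspace_cone unfolding cone_topology_def
    by (rule topology_generated_by_Basis) (use assms V in blast)
qed simp

text \<open>
  A neighbourhood in the cone topology tests only finitely many functions. This is what makes
  finite combinations of point masses dense.
\<close>
lemma cone_neighbourhood:
  assumes "openin cone_topology W" "\<mu> \<in> W"
  obtains F \<delta> where "finite F" "F \<subseteq> Cc_pos \<union> {\<lambda>x. 1}" "0 < \<delta>"
    "\<And>\<nu>. \<nu> \<in> pos_meas_space \<Longrightarrow> (\<And>f. f \<in> F \<Longrightarrow> \<bar>integ \<nu> f - integ \<mu> f\<bar> < \<delta>) \<Longrightarrow> \<nu> \<in> W"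
proof -
  let ?Q = "\<lambda>W. \<exists>F \<delta>. finite F \<and> F \<subseteq> Cc_pos \<union> {\<lambda>x. 1} \<and> 0 < \<delta> \<and>
    (\<forall>\<nu>\<in>pos_meas_space. (\<forall>f\<in>F. \<bar>integ \<nu> f - integ \<mu> f\<bar> < \<delta>) \<longrightarrow> \<nu> \<in> W)"
  have "generate_topology_on {{\<mu> \<in> pos_meas_space. integ \<mu> f \<in> V} |f V.
        f \<in> Cc_pos \<union> {\<lambda>x. 1} \<and> open V} W"
    using assms(1) unfolding cone_topology_def openin_topology_generated_by_iff .
  then have "\<mu> \<in> W \<longrightarrow> ?Q W"
  proof induction
    case (Int a b)
    show ?case
    proof
      assume "\<mu> \<in> a \<inter> b"
      with Int.IH have Q: "?Q a" "?Q b" by blast+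
      from Q(1) obtain F \<delta> where
        F: "finite F" "F \<subseteq> Cc_pos \<union> {\<lambda>x. 1}" "0 < \<delta>"
        "\<And>\<nu>. \<nu> \<in> pos_meas_space \<Longrightarrow> (\<forall>f\<in>F. \<bar>integ \<nu> f - integ \<mu> f\<bar> < \<delta>) \<Longrightarrow> \<nu> \<in> a"
        by blast
      from Q(2) obtain G \<epsilon> where
        G: "finite G" "G \<subseteq> Cc_pos \<union> {\<lambda>x. 1}" "0 < \<epsilon>"
        "\<And>\<nu>. \<nu> \<in> pos_meas_space \<Longrightarrow> (\<forall>f\<in>G. \<bar>integ \<nu> f - integ \<mu> f\<bar> < \<epsilon>) \<Longrightarrow> \<nu> \<in> b"
        by blast
      show "?Q (a \<inter> b)"
        by (intro exI[of _ "F \<union> G"] exI[of _ "min \<delta> \<epsilon>"]) (use F G in auto)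
    qed
  next
    case (UN \<K>)
    show ?case
    proof
      assume "\<mu> \<in> \<Union>\<K>"
      then obtain V where V: "V \<in> \<K>" "\<mu> \<in> V" by blast
      with UN.IH have "?Q V" by blast
      with V(1) show "?Q (\<Union>\<K>)" by blast
    qed
  next
    case (Basis s)
    then obtain f V where s: "s = {\<mu> \<in> pos_meas_space. integ \<mu> f \<in> V}"
      "f \<in> Cc_pos \<union> {\<lambda>x. 1}" "open V" by blast
    show ?case
    proof
      assume "\<mu> \<in> s"
      with s obtain \<delta> where "0 < \<delta>" and \<delta>: "ball (integ \<mu> f) \<delta> \<subseteq> V"
        by (auto simp: open_contains_ball)
      moreover have "integ \<nu> f \<in> V" if "\<bar>integ \<nu> f - integ \<mu> f\<bar> < \<delta>" for \<nu>
        using \<delta> that by (auto simp: dist_real_def abs_minus_commute)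
      ultimately show "?Q s"
        by (intro exI[of _ "{f}"] exI[of _ \<delta>]) (use s in auto)
    qed
  qed simp
  then have "?Q W" using assms(2) by (rule mp)
  then obtain F \<delta> where "finite F" "F \<subseteq> Cc_pos \<union> {\<lambda>x. 1}" "0 < \<delta>"
    "\<forall>\<nu>\<in>pos_meas_space. (\<forall>f\<in>F. \<bar>integ \<nu> f - integ \<mu> f\<bar> < \<delta>) \<longrightarrow> \<nu> \<in> W"
    by (elim exE conjE)
  then show thesis by (intro that[of F \<delta>]) simp_all
qed

lemma integ_point_mass:
  fixes f :: "'a::t2_space \<Rightarrow> real"
  assumes f: "f \<in> borel_measurable borel"
  shows "integ (point_mass x) f = f x"
proof -
  let ?M = "to_measure (point_mass x)"
  have "emeasure ?M (- {x}) = 0"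
    by (simp add: emeasure_to_measure point_mass_pos) (simp add: point_mass_def)
  then have "AE y in ?M. y = x" by (intro AE_I[where N="- {x}"]) auto
  then have "integ (point_mass x) f = integ (point_mass x) (\<lambda>_. f x)"
    using f by (intro integral_cong_AE) auto
  also have "\<dots> = f x" by (simp only: integ_const[OF point_mass_pos]) (simp add: point_mass_def)
  finally show ?thesis .
qed

lemma continuous_point_mass: "continuous_map euclidean cone_topology (point_mass :: 'a::t2_space \<Rightarrow> _)"
  unfolding cone_topology_def
proof (rule continuous_on_generated_topo)
  fix W assume "W \<in> {{\<mu> \<in> pos_meas_space. integ \<mu> f \<in> V} |(f :: 'a \<Rightarrow> real) V.
    f \<in> Cc_pos \<union> {\<lambda>x. 1} \<and> open V}"
  then obtain f :: "'a \<Rightarrow> real" and V where W: "W = {\<mu> \<in> pos_meas_space. integ \<mu> f \<in> V}"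
    and f: "f \<in> Cc_pos \<union> {\<lambda>x. 1}" and V: "open V" by blast
  have c: "continuous_on UNIV f" using f by (auto simp: Cc_pos_def)
  have "point_mass -` W = f -` V"
    using borel_measurable_continuous_onI[OF c] by (auto simp: W point_mass_pos integ_point_mass)
  then show "openin euclidean (point_mass -` W \<inter> topspace euclidean)"
    using open_vimage[OF V c] by simp
next
  show "point_mass ` topspace euclidean \<subseteq> \<Union> {{\<mu> \<in> pos_meas_space. integ \<mu> f \<in> V} |(f :: 'a \<Rightarrow> real) V.
    f \<in> Cc_pos \<union> {\<lambda>x. 1} \<and> open V}"
    using topspace_cone[where 'a='a] point_mass_pos
    unfolding cone_topology_def topology_generated_by_topspace by blast
qed

text \<open>
  Finitely many continuous functions are almost preserved by a single map \<open>r\<close> with finitely many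
  values: cut the space into the pieces on which all the integers \<open>\<lfloor>f y / \<eta>\<rfloor>\<close> are constant, and let \<open>r\<close>
  pick one point from each piece. Boundedness of the functions makes the number of pieces finite.
\<close>
lemma finite_range_approximation:
  fixes F :: "('a::t2_space \<Rightarrow> real) set"
  assumes K: "compact (UNIV :: 'a set)" and F: "finite F"
    and cont: "\<And>f. f \<in> F \<Longrightarrow> continuous_on UNIV f" and \<eta>: "0 < \<eta>"
  obtains r :: "'a \<Rightarrow> 'a" where "finite (range r)" "\<And>b. r -` {b} \<in> sets borel"
    "\<And>f y. f \<in> F \<Longrightarrow> \<bar>f (r y) - f y\<bar> \<le> \<eta>"
proof -
  define g where "g y = restrict (\<lambda>f. \<lfloor>f y / \<eta>\<rfloor>) F" for y
  have "finite (range (\<lambda>y. \<lfloor>f y / \<eta>\<rfloor>))" if f: "f \<in> F" for f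
  proof -
    obtain B where B: "\<And>y. \<bar>f y\<bar> \<le> B" using continuous_bounded[OF K cont[OF f]] by blast
    have "- (B / \<eta>) \<le> f y / \<eta>" "f y / \<eta> \<le> B / \<eta>" for y
      using B[of y] \<eta> by (auto simp: field_simps abs_le_iff)
    then have "\<lfloor>f y / \<eta>\<rfloor> \<in> {\<lfloor>- (B / \<eta>)\<rfloor>..\<lfloor>B / \<eta>\<rfloor>}" for y
      by (auto intro!: floor_mono)
    then show ?thesis by (meson finite_atLeastAtMost_int finite_subset image_subsetI)
  qed
  then have "finite (PiE F (\<lambda>f. range (\<lambda>y. \<lfloor>f y / \<eta>\<rfloor>)))" using F by (intro finite_PiE)
  moreover have "range g \<subseteq> PiE F (\<lambda>f. range (\<lambda>y. \<lfloor>f y / \<eta>\<rfloor>))" by (auto simp: g_def)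
  ultimately have fin: "finite (range g)" by (rule rev_finite_subset)
  define r where "r y = inv g (g y)" for y
  have gr: "g (r y) = g y" for y by (simp add: r_def f_inv_into_f)
  show thesis
  proof
    have "range r = inv g ` range g" by (auto simp: r_def)
    then show "finite (range r)" using fin by simp
  next
    fix b
    have fibre: "g -` {v} \<in> sets borel" if "v \<in> range g" for v
    proof -
      have "g -` {v} = (\<Inter>f\<in>F. {y. \<lfloor>f y / \<eta>\<rfloor> = v f}) \<inter> UNIV"
        using that by (auto simp: g_def fun_eq_iff restrict_def split: if_splits)
      also have "\<dots> \<in> sets borel"
      proof (cases "F = {}")
        case False
        have "{y. \<lfloor>f y / \<eta>\<rfloor> = v f} \<in> sets borel" if "f \<in> F" for f
        proof -
          have [measurable]: "f \<in> borel_measurable borel"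
            using borel_measurable_continuous_onI[OF cont[OF that]] .
          have "{y \<in> space borel. real_of_int (v f) \<le> f y / \<eta> \<and> f y / \<eta> < real_of_int (v f) + 1}
              \<in> sets borel" by measurable
          then show ?thesis by (simp add: floor_eq_iff)
        qed
        then show ?thesis using F False by (intro sets.Int sets.finite_INT) auto
      qed simp
      finally show ?thesis .
    qed
    have "r -` {b} = (if b \<in> range r then g -` {g b} else {})"
      using gr by (auto simp: r_def) (metis gr r_def)+
    then show "r -` {b} \<in> sets borel" using fibre by simp
  next
    fix f y assume "f \<in> F"
    then have "\<lfloor>f (r y) / \<eta>\<rfloor> = \<lfloor>f y / \<eta>\<rfloor>"
      using fun_cong[OF gr[of y], of f] by (simp add: g_def)
    then have "\<bar>f (r y) / \<eta> - f y / \<eta>\<bar> < 1" by linarith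
    then show "\<bar>f (r y) - f y\<bar> \<le> \<eta>"
      using \<eta> by (simp add: diff_divide_distrib[symmetric] field_simps)
  qed
qed

text \<open>
  Replacing \<open>\<mu>\<close> by its image under the map of \<open>finite_range_approximation\<close> moves it
  to a finite combination of point masses, on which \<open>T\<close> is integration of \<open>x \<mapsto> T p\<^sub>x\<close>. The map can be
  chosen to respect both the functions defining a neighbourhood on which \<open>T\<close> varies little and
  the function \<open>x \<mapsto> T p\<^sub>x\<close> itself, so both sides of the identity change
  arbitrarily little.
\<close>
lemma cone_linear_continuous_representation:
  fixes T :: "('a::t2_space set \<Rightarrow> complex) \<Rightarrow> real"
  assumes K: "compact (UNIV :: 'a set)" and lin: "cone_linear T"
    and cont: "continuous_map cone_topology euclidean T" and \<mu>: "\<mu> \<in> pos_meas_space"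
  shows "T \<mu> = integ \<mu> (\<lambda>x. T (point_mass x))"
proof -
  define \<phi> where "\<phi> x = T (point_mass x)" for x
  have \<phi>: "continuous_on UNIV \<phi>"
    using continuous_map_compose[OF continuous_point_mass cont] by (simp add: o_def \<phi>_def[abs_def])
  have "\<bar>T \<mu> - integ \<mu> \<phi>\<bar> < 2 * \<epsilon>" if \<epsilon>: "0 < \<epsilon>" for \<epsilon>
  proof -
    let ?W = "{\<nu> \<in> topspace cone_topology. T \<nu> \<in> ball (T \<mu>) \<epsilon>}"
    have "openin cone_topology ?W"
      by (rule openin_continuous_map_preimage[OF cont]) simp
    moreover have "\<mu> \<in> ?W" using \<mu> \<epsilon> by simp
    ultimately obtain F \<delta> where F: "finite F" "F \<subseteq> Cc_pos \<union> {\<lambda>x. 1}" "0 < \<delta>" and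
      W: "\<And>\<nu>. \<nu> \<in> pos_meas_space \<Longrightarrow> (\<And>f. f \<in> F \<Longrightarrow> \<bar>integ \<nu> f - integ \<mu> f\<bar> < \<delta>) \<Longrightarrow> \<nu> \<in> ?W"
      by (rule cone_neighbourhood) blast
    define m where "m = Re (\<mu> UNIV)"
    have m: "0 \<le> m" using pos_Re[OF \<mu>] by (simp add: m_def)
    \<comment> \<open>Adding 1 to the total mass allows for the zero measure.\<close>
    define \<eta> where "\<eta> = min \<delta> \<epsilon> / (m + 1)"
    have \<eta>: "0 < \<eta>" "\<eta> * m < \<delta>" "\<eta> * m < \<epsilon>"
    proof -
      show "0 < \<eta>" using m F \<epsilon> by (simp add: \<eta>_def)
      moreover have "\<eta> * m = min \<delta> \<epsilon> - \<eta>" using m by (simp add: \<eta>_def field_simps)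
      ultimately show "\<eta> * m < \<delta>" "\<eta> * m < \<epsilon>" by linarith+
    qed
    have c: "continuous_on UNIV f" if "f \<in> insert \<phi> F" for f
      using that \<phi> F(2) by (auto simp: Cc_pos_def)
    obtain r :: "'a \<Rightarrow> 'a" where r: "finite (range r)" "\<And>b. r -` {b} \<in> sets borel"
      "\<And>f y. f \<in> insert \<phi> F \<Longrightarrow> \<bar>f (r y) - f y\<bar> \<le> \<eta>"
      using finite_range_approximation[OF K _ c \<eta>(1), of "insert \<phi> F"] F(1) by auto
    \<comment> \<open>The image of \<open>\<mu>\<close> under \<open>r\<close> has mass \<open>w b\<close> at each value \<open>b\<close> of \<open>r\<close>.\<close>
    define w where "w b = Re (\<mu> (r -` {b}))" for b
    have w: "0 \<le> w b" for b using pos_Re[OF \<mu>] by (simp add: w_def)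
    define S where "S = range r"
    interpret finite_measure "to_measure \<mu>" by (rule finite_to_measure[OF \<mu>])
    have close: "\<bar>(\<Sum>b\<in>S. w b * f b) - integ \<mu> f\<bar> \<le> \<eta> * m" if f: "f \<in> insert \<phi> F" for f
    proof -
      have fr: "f (r y) = (\<Sum>b\<in>S. f b * indicator (r -` {b}) y)" for y
        using r(1) by (simp add: S_def indicator_def sum.delta if_distrib cong: if_cong)
      have ii: "integrable (to_measure \<mu>) (\<lambda>y. f (r y))"
        unfolding fr using r(2)
        by (intro Bochner_Integration.integrable_sum integrable_mult_right integrable_real_indicator)
          (auto simp: less_top[symmetric])
      have "integ \<mu> (\<lambda>y. f (r y)) = (\<Sum>b\<in>S. f b * measure (to_measure \<mu>) (r -` {b}))"
        unfolding fr using r(2)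
        by (subst Bochner_Integration.integral_sum)
          (auto simp: less_top[symmetric] intro!: integrable_mult_right integrable_real_indicator)
      then have eq: "(\<Sum>b\<in>S. w b * f b) = integ \<mu> (\<lambda>y. f (r y))"
        using r(2) by (simp add: measure_to_measure \<mu> w_def mult.commute)
      have i: "integrable (to_measure \<mu>) f" by (rule integrable_continuous_pos[OF K c[OF f] \<mu>])
      have "\<bar>integ \<mu> (\<lambda>y. f (r y) - f y)\<bar> \<le> integ \<mu> (\<lambda>y. \<bar>f (r y) - f y\<bar>)"
        by (rule integral_abs_bound)
      also have "\<dots> \<le> integ \<mu> (\<lambda>y. \<eta>)"
        using r(3)[OF f] ii i by (intro integral_mono) auto
      also have "\<dots> = \<eta> * m" using integ_const[OF \<mu>, of \<eta>] by (simp add: m_def mult.commute)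
      finally show ?thesis using ii i by (simp add: eq)
    qed
    have d: "atomic_measure w S \<in> pos_meas_space" using r(1) w by (intro atomic_measure_pos) (auto simp: S_def)
    have "atomic_measure w S \<in> ?W"
    proof (rule W[OF d])
      fix f assume f: "f \<in> F"
      then have c: "continuous_on UNIV f" and f0: "\<And>x. 0 \<le> f x" using c F(2) by (auto simp: Cc_pos_def)
      have fm: "f \<in> borel_measurable borel" using borel_measurable_continuous_onI[OF c] .
      obtain B where "\<And>x. \<bar>f x\<bar> \<le> B" using continuous_bounded[OF K c] by blast
      then have B: "\<And>x. f x \<le> B" by (meson abs_le_D1)
      have "integ (atomic_measure w S) f = (\<Sum>b\<in>S. w b * f b)"
        using cone_linear_atomic[OF cone_linear_integ[OF fm f0 B], of S w] w r(1)
        by (simp add: S_def integ_point_mass[OF fm])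
      then show "\<bar>integ (atomic_measure w S) f - integ \<mu> f\<bar> < \<delta>" using close[of f] f \<eta> by simp
    qed
    moreover have "T (atomic_measure w S) = (\<Sum>b\<in>S. w b * \<phi> b)"
      using cone_linear_atomic[OF lin, of S w] w r(1) by (simp add: S_def \<phi>_def)
    ultimately show ?thesis using close[of \<phi>] \<eta>(3) by (auto simp: dist_real_def)
  qed
  from this[of "\<bar>T \<mu> - integ \<mu> \<phi>\<bar> / 2"] have "T \<mu> = integ \<mu> \<phi>" by fastforce
  then show ?thesis by (simp add: \<phi>_def[abs_def])
qed


lemma cone_linear_integ_continuous:
  fixes f :: "'a::t2_space \<Rightarrow> real"
  assumes K: "compact (UNIV :: 'a set)" and f: "continuous_on UNIV f" "\<And>x. 0 \<le> f x"
  shows "cone_linear (\<lambda>\<mu>. integ \<mu> f)"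
proof -
  obtain B where "\<And>x. \<bar>f x\<bar> \<le> B" using continuous_bounded[OF K f(1)] by blast
  then have "\<And>x. f x \<le> B" by (meson abs_le_D1)
  then show ?thesis by (rule cone_linear_integ[OF borel_measurable_continuous_onI[OF f(1)] f(2)])
qed

section \<open>Supports\<close>
lemma Hausdorff_space_t2: "Hausdorff_space (euclidean :: 'a::t2_space topology)"
  unfolding Hausdorff_space_def using hausdorff by (auto simp: disjnt_def)

lemma compact_separating_function:
  fixes C :: "'a::t2_space set"
  assumes K: "compact (UNIV :: 'a set)" and C: "closed C" and z: "z \<notin> C"
  obtains f :: "'a \<Rightarrow> real" where "continuous_on UNIV f" "\<And>x. 0 \<le> f x" "f z = 1" "\<And>x. x \<in> C \<Longrightarrow> f x = 0"
proof -
  have "compact_space (euclidean :: 'a topology)" using K by (simp add: compact_space_def)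
  then have "completely_regular_space (euclidean :: 'a topology)"
    using locally_compact_regular_imp_completely_regular_space compact_imp_locally_compact_space
      Hausdorff_space_t2 by blast
  then obtain g :: "'a \<Rightarrow> real" where g: "continuous_map euclidean (top_of_set {0..1}) g" "g z = 0" "g ` C \<subseteq> {1}"
    using C z unfolding completely_regular_space_def by (metis DiffI UNIV_I closed_closedin topspace_euclidean)
  have "continuous_on UNIV g" and g01: "g x \<in> {0..1}" for x
    using g(1) by (auto simp: continuous_map_in_subtopology)
  then show thesis using g(2,3)
    by (intro that[of "\<lambda>x. 1 - g x"]) (auto intro!: continuous_intros)
qed

lemma mem_meas_supp:
  assumes "\<mu> \<in> pos_meas_space"
  shows "x \<in> meas_supp \<mu> \<longleftrightarrow> (\<forall>U. open U \<and> x \<in> U \<longrightarrow> emeasure (to_measure \<mu>) U \<noteq> 0)"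
  using assms by (auto simp: meas_supp_def total_variation_pos zero_less_iff_neq_zero)

text \<open>
  That no mass lies outside the support is a matter of inner regularity: a compact set avoiding
  the support is covered by finitely many open null sets.
\<close>
lemma emeasure_outside_supp:
  fixes \<mu> :: "'a::t2_space set \<Rightarrow> complex"
  assumes \<mu>: "\<mu> \<in> pos_meas_space" and C: "closed C"
  shows "emeasure (to_measure \<mu>) (- C) = 0 \<longleftrightarrow> meas_supp \<mu> \<subseteq> C"
proof
  assume "emeasure (to_measure \<mu>) (- C) = 0"
  then show "meas_supp \<mu> \<subseteq> C" using C by (auto simp: mem_meas_supp[OF \<mu>] dest!: spec[of _ "- C"])
next
  assume supp: "meas_supp \<mu> \<subseteq> C"
  have "emeasure (to_measure \<mu>) D = 0" if D: "compact D" "D \<subseteq> - C" for D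
  proof -
    let ?N = "{U. open U \<and> emeasure (to_measure \<mu>) U = 0}"
    have "D \<subseteq> \<Union>?N" using D(2) supp mem_meas_supp[OF \<mu>] by blast
    moreover have "\<forall>U\<in>?N. open U" by blast
    ultimately have "\<exists>N\<subseteq>?N. finite N \<and> D \<subseteq> \<Union>N"
      using D(1)[unfolded compact_eq_Heine_Borel, rule_format, of ?N] by blast
    then obtain N where N: "N \<subseteq> ?N" "finite N" "D \<subseteq> \<Union>N" by (elim exE conjE)
    have "(\<Union>N) \<in> null_sets (to_measure \<mu>)"
      using N by (intro null_sets.finite_Union) (auto simp: null_sets_def)
    then show ?thesis using N(3)
      by (metis D(1) borel_compact emeasure_mono le_zero_eq null_setsD1 null_setsD2)
  qed
  then have null: "total_variation \<mu> D \<le> 0" if "D \<in> {D. compact D \<and> D \<subseteq> - C}" for D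
    using that by (simp add: total_variation_pos[OF \<mu>] borel_compact)
  have "total_variation \<mu> (- C) = (SUP D\<in>{D. compact D \<and> D \<subseteq> - C}. total_variation \<mu> D)"
  proof -
    have "regular_measure \<mu>" using \<mu> by (simp add: pos_meas_space_def meas_space_def)
    moreover have "- C \<in> sets borel" using C by simp
    ultimately show ?thesis unfolding regular_measure_def by blast
  qed
  also have "\<dots> \<le> 0" by (rule SUP_least[OF null])
  finally have "total_variation \<mu> (- C) \<le> 0" .
  then show "emeasure (to_measure \<mu>) (- C) = 0"
    using C by (simp add: total_variation_pos[OF \<mu>])
qed

lemma prob_supp_subset_iff:
  fixes \<mu> :: "'a::t2_space set \<Rightarrow> complex"
  assumes \<mu>: "\<mu> \<in> pos_meas_space" and one: "\<mu> UNIV = 1" and C: "closed C"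
  shows "\<mu> C = 1 \<longleftrightarrow> meas_supp \<mu> \<subseteq> C"
proof -
  interpret finite_measure "to_measure \<mu>" by (rule finite_to_measure[OF \<mu>])
  have "measure (to_measure \<mu>) (- C) = 1 - Re (\<mu> C)"
    using finite_measure_compl[of C] C one by (simp add: measure_to_measure \<mu> Compl_eq_Diff_UNIV)
  then have "emeasure (to_measure \<mu>) (- C) = 0 \<longleftrightarrow> Re (\<mu> C) = 1"
    using measure_nonneg[of "to_measure \<mu>" "- C"]
    by (auto simp: emeasure_eq_measure ennreal_eq_0_iff)
  also have "\<dots> \<longleftrightarrow> \<mu> C = 1" using pos_Re(2)[OF \<mu>, of C] by (metis of_real_1 one_complex.sel(1))
  finally show ?thesis using emeasure_outside_supp[OF \<mu> C] by simp
qed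

lemma meas_supp_nonempty:
  fixes \<mu> :: "'a::t2_space set \<Rightarrow> complex"
  assumes \<mu>: "\<mu> \<in> pos_meas_space" and one: "\<mu> UNIV = 1"
  shows "meas_supp \<mu> \<noteq> {}"
proof
  assume "meas_supp \<mu> = {}"
  then have "emeasure (to_measure \<mu>) (- {}) = 0" by (simp only: emeasure_outside_supp[OF \<mu>] closed_empty)
  then show False using one by (simp add: emeasure_to_measure[OF \<mu>])
qed

lemma integ_eq_0_iff_supp:
  fixes f :: "'a::t2_space \<Rightarrow> real"
  assumes K: "compact (UNIV :: 'a set)" and \<mu>: "\<mu> \<in> pos_meas_space"
    and f: "continuous_on UNIV f" "\<And>x. 0 \<le> f x"
  shows "integ \<mu> f = 0 \<longleftrightarrow> (\<forall>x\<in>meas_supp \<mu>. f x = 0)"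
proof -
  have C: "closed {x. f x = 0}" using f(1) by (intro closed_Collect_eq) auto
  have [measurable]: "f \<in> borel_measurable borel" by (rule borel_measurable_continuous_onI[OF f(1)])
  have "integ \<mu> f = 0 \<longleftrightarrow> (AE x in to_measure \<mu>. f x = 0)"
    using f(2) by (intro integral_nonneg_eq_0_iff_AE integrable_continuous_pos[OF K f(1) \<mu>]) auto
  also have "\<dots> \<longleftrightarrow> emeasure (to_measure \<mu>) (- {x. f x = 0}) = 0"
    using C by (subst AE_iff_measurable[of "- {x. f x = 0}"]) auto
  also have "\<dots> \<longleftrightarrow> (\<forall>x\<in>meas_supp \<mu>. f x = 0)"
    using emeasure_outside_supp[OF \<mu> C] by auto
  finally show ?thesis .
qed

text \<open>
  Supports are detected by integrals. A point of the support outside \<open>C\<close> is separated from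
  \<open>C\<close> by a continuous function, whose integral is then positive.
\<close>
lemma supp_subset_iff_integ:
  fixes C :: "'a::t2_space set"
  assumes K: "compact (UNIV :: 'a set)" and \<mu>: "\<mu> \<in> pos_meas_space" and C: "closed C"
  shows "meas_supp \<mu> \<subseteq> C \<longleftrightarrow>
    (\<forall>f. continuous_on UNIV f \<and> (\<forall>x. 0 \<le> f x) \<and> (\<forall>x\<in>C. f x = 0) \<longrightarrow> integ \<mu> f = 0)"
proof
  assume "meas_supp \<mu> \<subseteq> C"
  then show "\<forall>f. continuous_on UNIV f \<and> (\<forall>x. 0 \<le> f x) \<and> (\<forall>x\<in>C. f x = 0) \<longrightarrow> integ \<mu> f = 0"
    by (auto simp: integ_eq_0_iff_supp[OF K \<mu>])
next
  assume R: "\<forall>f. continuous_on UNIV f \<and> (\<forall>x. 0 \<le> f x) \<and> (\<forall>x\<in>C. f x = 0) \<longrightarrow> integ \<mu> f = 0"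
  show "meas_supp \<mu> \<subseteq> C"
  proof (rule subsetI, rule ccontr)
    fix z assume z: "z \<in> meas_supp \<mu>" "z \<notin> C"
    obtain f :: "'a \<Rightarrow> real" where f: "continuous_on UNIV f" "\<And>x. 0 \<le> f x" "f z = 1" "\<And>x. x \<in> C \<Longrightarrow> f x = 0"
      using compact_separating_function[OF K C z(2)] by blast
    then have "integ \<mu> f = 0" using R by blast
    then show False using integ_eq_0_iff_supp[OF K \<mu> f(1,2)] z(1) f(3) by auto
  qed
qed

text \<open>
  Right and left convolution by a fixed positive measure are the two instances of \<open>\<Phi>\<close>. The
  representation theorem turns \<open>\<integral> f d(\<Phi> \<mu>)\<close> into the integral over \<open>\<mu>\<close> of the non-negative continuous
  function \<open>b \<mapsto> \<integral> f d(\<Phi> p\<^sub>b)\<close>, which vanishes exactly when that function is zero on the support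
  of \<open>\<mu>\<close>.
\<close>
lemma supp_of_linear_image:
  fixes \<Phi> :: "('a::t2_space set \<Rightarrow> complex) \<Rightarrow> 'a set \<Rightarrow> complex"
  assumes K: "compact (UNIV :: 'a set)"
    and pos: "\<And>\<mu>. \<mu> \<in> pos_meas_space \<Longrightarrow> \<Phi> \<mu> \<in> pos_meas_space"
    and add: "\<And>\<mu> \<nu>. \<mu> \<in> pos_meas_space \<Longrightarrow> \<nu> \<in> pos_meas_space \<Longrightarrow>
      \<Phi> (\<lambda>A. \<mu> A + \<nu> A) = (\<lambda>A. \<Phi> \<mu> A + \<Phi> \<nu> A)"
    and scale: "\<And>\<mu> c. \<mu> \<in> pos_meas_space \<Longrightarrow> \<Phi> (\<lambda>A. c * \<mu> A) = (\<lambda>A. c * \<Phi> \<mu> A)"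
    and cont: "continuous_map cone_topology cone_topology \<Phi>"
    and \<mu>: "\<mu> \<in> pos_meas_space" and C: "closed C"
  shows "meas_supp (\<Phi> \<mu>) \<subseteq> C \<longleftrightarrow> (\<forall>b\<in>meas_supp \<mu>. meas_supp (\<Phi> (point_mass b)) \<subseteq> C)"
proof -
  have "integ (\<Phi> \<mu>) f = 0 \<longleftrightarrow> (\<forall>b\<in>meas_supp \<mu>. integ (\<Phi> (point_mass b)) f = 0)"
    if f: "continuous_on UNIV f" "\<And>x. 0 \<le> f x" for f
  proof -
    let ?T = "\<lambda>\<mu>. integ (\<Phi> \<mu>) f"
    have "cone_linear ?T"
      unfolding cone_linear_def
    proof (intro conjI ballI allI impI)
      fix \<mu> \<nu> :: "'a set \<Rightarrow> complex"
      assume m: "\<mu> \<in> pos_meas_space" "\<nu> \<in> pos_meas_space" "(\<lambda>A. \<mu> A + \<nu> A) \<in> pos_meas_space"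
      show "?T (\<lambda>A. \<mu> A + \<nu> A) = ?T \<mu> + ?T \<nu>"
        using cone_linear_integ_continuous[OF K f] pos[OF m(3)] pos[OF m(1)] pos[OF m(2)]
        unfolding add[OF m(1,2)] cone_linear_def by blast
    next
      fix \<mu> :: "'a set \<Rightarrow> complex" and c :: real
      assume m: "\<mu> \<in> pos_meas_space" "(\<lambda>A. complex_of_real c * \<mu> A) \<in> pos_meas_space" "0 \<le> c"
      show "?T (\<lambda>A. complex_of_real c * \<mu> A) = c * ?T \<mu>"
        using cone_linear_integ_continuous[OF K f] pos[OF m(2)] pos[OF m(1)] m(3)
        unfolding scale[OF m(1)] cone_linear_def by blast
    qed
    moreover have T: "continuous_map cone_topology euclidean ?T"
      using continuous_map_compose[OF cont continuous_integ[of f]] Cc_posI[OF K f] by (simp add: o_def)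
    ultimately have "?T \<mu> = integ \<mu> (\<lambda>b. ?T (point_mass b))"
      by (rule cone_linear_continuous_representation[OF K _ _ \<mu>])
    moreover have "continuous_on UNIV (\<lambda>b. ?T (point_mass b))"
      using continuous_map_compose[OF continuous_point_mass T] by (simp add: o_def)
    moreover have "0 \<le> ?T (point_mass b)" for b using f(2) by (intro integral_nonneg_AE) auto
    ultimately show ?thesis using integ_eq_0_iff_supp[OF K \<mu>] by simp
  qed
  then show ?thesis
    unfolding supp_subset_iff_integ[OF K pos[OF \<mu>] C] supp_subset_iff_integ[OF K pos[OF point_mass_pos] C]
    by blast
qed

text \<open>
  Upper semicontinuity makes the graph \<open>{(a, z). z \<in> S a}\<close> closed, and the union is the
  projection of a compact part of it.
\<close>
lemma compact_Union_michael:
  fixes S :: "'b::t2_space \<Rightarrow> 'a::t2_space set"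
  assumes K: "compact (UNIV :: 'a set)"
    and cont: "continuous_map euclidean michael_topology S"
    and ne: "\<And>a. S a \<noteq> {}" and comp: "\<And>a. compact (S a)" and A: "compact A"
  shows "compact (\<Union>a\<in>A. S a)"
proof -
  let ?R = "{p. snd p \<in> S (fst p)}"
  have "closed ?R" unfolding closed_def
  proof (subst open_subopen, rule ballI)
    fix p assume "p \<in> - ?R"
    then have "disjnt (S (fst p)) {snd p}" by simp
    moreover have "compactin euclidean (S (fst p))" "compactin euclidean {snd p}" using comp by auto
    ultimately obtain V W where "openin euclidean V" "openin euclidean W"
      "S (fst p) \<subseteq> V" "{snd p} \<subseteq> W" "disjnt V W"
      using Hausdorff_space_compact_separation[OF Hausdorff_space_t2] by metis
    then have VW: "open V" "open W" "S (fst p) \<subseteq> V" "snd p \<in> W" "disjnt V W" by simp_all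
    \<comment> \<open>With \<open>U = UNIV\<close> a sub-basic set only says that \<open>C\<close> is non-empty and contained in \<open>V\<close>.\<close>
    let ?N = "{C. compact C \<and> C \<inter> UNIV \<noteq> {} \<and> C \<subseteq> V}"
    have "openin michael_topology ?N"
      unfolding michael_topology_def
      by (rule topology_generated_by_Basis) (use VW(1) open_UNIV in blast)
    then have "openin euclidean {a \<in> topspace euclidean. S a \<in> ?N}"
      by (rule openin_continuous_map_preimage[OF cont])
    then have o: "open {a. S a \<subseteq> V}" using ne comp by simp
    show "\<exists>T. open T \<and> p \<in> T \<and> T \<subseteq> - ?R"
    proof (intro exI conjI)
      show "open ({a. S a \<subseteq> V} \<times> W)" using o VW by (intro open_Times)
      show "p \<in> {a. S a \<subseteq> V} \<times> W" using VW by (cases p) auto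
      show "{a. S a \<subseteq> V} \<times> W \<subseteq> - ?R" using VW(5) by (auto simp: disjnt_def)
    qed
  qed
  then have "compact (?R \<inter> (A \<times> UNIV))"
    using A K by (intro closed_Int_compact compact_Times)
  then have "compact (snd ` (?R \<inter> (A \<times> UNIV)))"
    by (rule compact_continuous_image[rotated]) (intro continuous_intros)
  moreover have "snd ` (?R \<inter> (A \<times> UNIV)) = (\<Union>a\<in>A. S a)" by force
  ultimately show ?thesis by simp
qed

section \<open>Ideals of a compact semitopological semihypergroup\<close>
context semitopological_semihypergroup
begin

abbreviation point_supp :: "'a \<Rightarrow> 'a \<Rightarrow> 'a set" where
  "point_supp x y \<equiv> meas_supp (conv (point_mass x) (point_mass y))"

lemma pos_meas: "\<mu> \<in> pos_meas_space \<Longrightarrow> \<mu> \<in> meas_space"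
  by (simp add: pos_meas_space_def)

lemma supp_conv_left_iff:
  assumes "compact (UNIV :: 'a set)" "\<mu> \<in> pos_meas_space" "\<nu> \<in> pos_meas_space" "closed C"
  shows "meas_supp (conv \<mu> \<nu>) \<subseteq> C \<longleftrightarrow> (\<forall>b\<in>meas_supp \<mu>. meas_supp (conv (point_mass b) \<nu>) \<subseteq> C)"
  using assms
  by (intro supp_of_linear_image[where \<Phi> = "\<lambda>\<mu>. conv \<mu> \<nu>"])
    (auto simp: conv_pos conv_add_left conv_scale_left pos_meas continuous_right)

lemma supp_conv_right_iff:
  assumes "compact (UNIV :: 'a set)" "\<mu> \<in> pos_meas_space" "\<nu> \<in> pos_meas_space" "closed C"
  shows "meas_supp (conv \<mu> \<nu>) \<subseteq> C \<longleftrightarrow> (\<forall>b\<in>meas_supp \<nu>. meas_supp (conv \<mu> (point_mass b)) \<subseteq> C)"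
  using assms
  by (intro supp_of_linear_image[where \<Phi> = "\<lambda>\<nu>. conv \<mu> \<nu>"])
    (auto simp: conv_pos conv_add_right conv_scale_right pos_meas continuous_left)

lemma left_ideal_iff:
  "left_ideal conv I \<longleftrightarrow> closed I \<and> I \<noteq> {} \<and> (\<forall>x. \<forall>a\<in>I. point_supp x a \<subseteq> I)"
  unfolding left_ideal_def using prob_supp_subset_iff[OF conv_point_pos conv_point_prob] by blast

lemma right_ideal_iff:
  "right_ideal conv I \<longleftrightarrow> closed I \<and> I \<noteq> {} \<and> (\<forall>x. \<forall>a\<in>I. point_supp a x \<subseteq> I)"
  unfolding right_ideal_def using prob_supp_subset_iff[OF conv_point_pos conv_point_prob] by blast

lemma point_supp_nonempty: "point_supp x y \<noteq> {}"
  by (rule meas_supp_nonempty[OF conv_point_pos conv_point_prob])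

text \<open>
  The intersection \<open>J \<inter> M\<close> contains the support of \<open>p\<^sub>a * p\<^sub>m\<close> for \<open>a \<in> J\<close> and \<open>m \<in> M\<close>, so it is a
  left ideal, and minimality of \<open>M\<close> applies.
\<close>
lemma minimal_left_ideal_subset_ideal:
  assumes M: "M \<in> minimal_left_ideals conv" and J: "two_sided_ideal conv J"
  shows "M \<subseteq> J"
proof -
  have M': "left_ideal conv M" using M by (simp add: minimal_left_ideals_def)
  have J': "left_ideal conv J" "right_ideal conv J" using J by (auto simp: two_sided_ideal_def)
  obtain a m where "a \<in> J" "m \<in> M" using M' J' by (auto simp: left_ideal_iff)
  then have "point_supp a m \<subseteq> J \<inter> M" using M' J' by (simp add: left_ideal_iff right_ideal_iff)
  then have "J \<inter> M \<noteq> {}" using point_supp_nonempty[of a m] by blast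
  then have "left_ideal conv (J \<inter> M)" using M' J' by (auto simp: left_ideal_iff)
  then have "J \<inter> M = M" using M unfolding minimal_left_ideals_def by blast
  then show ?thesis by blast
qed

text \<open>
  Let \<open>b\<close> be in the support of \<open>p\<^sub>a * p\<^sub>y\<close> with \<open>a \<in> I\<close>. The support of \<open>p\<^sub>x * p\<^sub>b\<close> is contained in that
  of \<open>(p\<^sub>x * p\<^sub>a) * p\<^sub>y\<close>, hence in \<open>I * K\<close> because the support of \<open>p\<^sub>x * p\<^sub>a\<close> is contained in the left ideal
  \<open>I\<close>. The support of \<open>p\<^sub>b * p\<^sub>x\<close> is contained in that of \<open>p\<^sub>a * (p\<^sub>y * p\<^sub>x)\<close>, which is in \<open>I * K\<close>
  because \<open>a \<in> I\<close>. Closedness is where joint continuity of the supports is used.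
\<close>
lemma two_sided_ideal_left_ideal_conv:
  assumes K: "compact (UNIV :: 'a set)" and I: "left_ideal conv I"
  shows "two_sided_ideal conv (set_conv conv I UNIV)"
proof -
  let ?J = "set_conv conv I UNIV"
  have I': "closed I" "I \<noteq> {}" "\<And>x a. a \<in> I \<Longrightarrow> point_supp x a \<subseteq> I"
    using I by (auto simp: left_ideal_iff)
  have "compact (\<Union>p\<in>I \<times> UNIV. (\<lambda>(x, y). point_supp x y) p)"
  proof (rule compact_Union_michael[OF K])
    show "continuous_map euclidean michael_topology (\<lambda>(x, y). point_supp x y)"
      using continuous_supp by simp
    show "compact (I \<times> (UNIV :: 'a set))"
      using K I'(1) compact_Int_closed[OF K I'(1)] by (intro compact_Times) simp_all
  qed (auto simp: point_supp_nonempty compact_supp)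
  moreover have "(\<Union>p\<in>I \<times> UNIV. (\<lambda>(x, y). point_supp x y) p) = ?J" by (auto simp: set_conv_def)
  ultimately have cJ: "closed ?J" by (metis compact_imp_closed)
  have J: "point_supp a y \<subseteq> ?J" if "a \<in> I" for a y using that by (auto simp: set_conv_def)
  have assoc: "conv (conv (point_mass a) (point_mass b)) (point_mass c)
      = conv (point_mass a) (conv (point_mass b) (point_mass c))" for a b c :: 'a
    by (simp add: conv_assoc pos_meas point_mass_pos)
  note left = supp_conv_left_iff[OF K conv_point_pos point_mass_pos cJ]
  note right = supp_conv_right_iff[OF K point_mass_pos conv_point_pos cJ]
  have "point_supp x b \<subseteq> ?J \<and> point_supp b x \<subseteq> ?J" if bJ: "b \<in> ?J" for x b
  proof -
    obtain a y where a: "a \<in> I" and b: "b \<in> point_supp a y" using bJ by (auto simp: set_conv_def)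
    have "meas_supp (conv (conv (point_mass x) (point_mass a)) (point_mass y)) \<subseteq> ?J"
      unfolding left using I'(3)[OF a] J by blast
    then have 1: "point_supp x b \<subseteq> ?J" using b unfolding assoc right by blast
    have "meas_supp (conv (point_mass a) (conv (point_mass y) (point_mass x))) \<subseteq> ?J"
      unfolding right using J[OF a] by blast
    then have "point_supp b x \<subseteq> ?J" using b unfolding assoc[symmetric] left by blast
    with 1 show ?thesis by blast
  qed
  moreover have "?J \<noteq> {}" using I'(2) point_supp_nonempty by (force simp: set_conv_def)
  ultimately show ?thesis using cJ by (auto simp: two_sided_ideal_def left_ideal_iff right_ideal_iff)
qed

end

theorem theorem5p14:
  fixes conv :: "('a::t2_space set \<Rightarrow> complex) \<Rightarrow> ('a set \<Rightarrow> complex) \<Rightarrow> ('a set \<Rightarrow> complex)"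
    and I :: "'a set"
  assumes "semitopological_semihypergroup conv"
    and "compact (UNIV :: 'a set)"
    and "I \<in> minimal_left_ideals conv"
  shows "(\<Union>M\<in>minimal_left_ideals conv. M) \<subseteq> Ker conv \<and>
         Ker conv \<subseteq> (\<Union>x\<in>UNIV. set_conv conv I {x})"
proof -
  interpret semitopological_semihypergroup conv by (rule assms(1))
  have "left_ideal conv I" using assms(3) by (simp add: minimal_left_ideals_def)
  then have "Ker conv \<subseteq> set_conv conv I UNIV"
    using two_sided_ideal_left_ideal_conv[OF assms(2)] by (auto simp: Ker_def)
  also have "set_conv conv I UNIV = (\<Union>x\<in>UNIV. set_conv conv I {x})" by (auto simp: set_conv_def)
  finally show ?thesis using minimal_left_ideal_subset_ideal by (auto simp: Ker_def)
qed

end
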